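(* Let $1\le m<d$, $\sigma>0$, $\mu_1,\dots,\mu_m\in\mathbb{R}$, and let $\epsilon_1,\dots,\epsilon_d$ be independent Gaussian random variables with mean $0$ and standard deviation $\sigma$. Let $X=(\mu_1+\epsilon_1,\dots,\mu_m+\epsilon_m,\epsilon_{m+1},\dots,\epsilon_d)\in\mathbb{R}^d/\mathbb{R}{\bf 1}$, and let $X'\in\mathbb{R}^d/\mathbb{R}{\bf 1}$ be the projected point of $X$ onto the $(m-1)$-dimensional Stiefel tropical linear space $L(A_{m-1})$ of the $m\times d$ matrix $A_{m-1}$ whose $(i,j)$ entry is $\mu_i$ if $j=i$, $-\infty$ if $j\le m$ and $j\ne i$, and $0$ if $j>m$: $$A_{m-1}=\begin{pmatrix}\mu_1&-\infty&\cdots&-\infty&0&\cdots&0\\-\infty&\mu_2&\cdots&-\infty&0&\cdots&0\\\vdots&\vdots&\ddots&\vdots&\vdots&&\vdots\\-\infty&-\infty&\cdots&\mu_m&0&\cdots&0\end{pmatrix}.$$ Then $\lim_{\sigma\to 0}\mathbb{E}[d_{\rm tr}(X,X')]=0$.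
   Context: ${\bf 1}=(1,\dots,1)$, $[d]=\{1,\dots,d\}$. Tropical distance: $d_{\rm tr}(v,w)=\max_i(v_i-w_i)-\min_i(v_i-w_i)$. The tropical determinant of a $q\times q$ matrix $B$ over $\mathbb{R}\cup\{-\infty\}$ is $\mathrm{tdet}(B)=\max_{\sigma\in S_q}\sum_{i}B_{i,\sigma(i)}$. For an $m\times d$ matrix $A$ with $m<d$, $p_A(\omega)=\mathrm{tdet}(A_\omega)$ for $m$-subsets $\omega\subseteq[d]$, where $A_\omega$ consists of the columns of $A$ indexed by $\omega$; these are the tropical Plücker coordinates. The Stiefel tropical linear space $L(A)$ is the set of $x\in(\mathbb{R}\cup\{-\infty\})^d/\mathbb{R}{\bf 1}$ such that for every $(m+1)$-subset $\tau\subseteq[d]$ the maximum of $p_A(\tau\setminus\{t\})+x_t$ over $t\in\tau$ is attained at least twice. The projected point of $u\in\mathbb{R}^d/\mathbb{R}{\bf 1}$ onto $L(A)$ is the point $w$ given by the Blue Rule: $w_i=\max_{\tau}\min_{j\notin\tau}\{u_j+p_A(\tau\cup\{i\})-p_A(\tau\cup\{j\})\}$, where $\tau$ runs over $(m-1)$-subsets of $[d]$ not containing $i$; it is a known fact that $w\in L(A)$ and $w$ minimizes $d_{\rm tr}(u,\cdot)$ over $L(A)$. *)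

theory Defs
  imports "HOL-Probability.Probability" "HOL-Combinatorics.Permutations"
begin

text \<open>
  The index set \<open>[d]\<close> is \<^term>\<open>{1..d}\<close>. A point of the tropical torus
  \<open>\<real>\<^sup>d/\<real>\<one>\<close> is given by a representative \<^typ>\<open>nat \<Rightarrow> real\<close>, of which only the
  coordinates in \<^term>\<open>{1..d}\<close> matter; \<open>trop_dist_shift\<close> and \<open>blue_proj_shift\<close> below show that
  the constructions do not depend on the representative. Matrices over \<open>\<real> \<union> {-\<infinity>}\<close> are functions
  \<^typ>\<open>nat \<Rightarrow> nat \<Rightarrow> ereal\<close> with 1-based row and column indices.
\<close>

definition trop_dist :: "nat \<Rightarrow> (nat \<Rightarrow> real) \<Rightarrow> (nat \<Rightarrow> real) \<Rightarrow> real" where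
  "trop_dist d v w = Max ((\<lambda>i. v i - w i) ` {1..d}) - Min ((\<lambda>i. v i - w i) ` {1..d})"

definition tdet :: "nat \<Rightarrow> (nat \<Rightarrow> nat \<Rightarrow> ereal) \<Rightarrow> ereal" where
  "tdet q B = Max ((\<lambda>\<pi>. \<Sum>i=1..q. B i (\<pi> i)) ` {\<pi>. \<pi> permutes {1..q}})"

definition select_cols :: "(nat \<Rightarrow> nat \<Rightarrow> ereal) \<Rightarrow> nat set \<Rightarrow> nat \<Rightarrow> nat \<Rightarrow> ereal" where
  "select_cols A \<omega> = (\<lambda>i j. A i (sorted_list_of_set \<omega> ! (j - 1)))"

definition trop_pluecker :: "nat \<Rightarrow> (nat \<Rightarrow> nat \<Rightarrow> ereal) \<Rightarrow> nat set \<Rightarrow> ereal" where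
  "trop_pluecker m A \<omega> = tdet m (select_cols A \<omega>)"

text \<open>
  The Blue Rule: the projected point of \<open>u\<close> onto the Stiefel tropical linear space of the
  \<open>m \<times> d\<close> matrix \<open>A\<close>, i.e. the one with Pluecker coordinates \<^term>\<open>trop_pluecker m A\<close>. On \<^typ>\<open>ereal\<close> we have \<open>a - (-\<infinity>) = \<infinity>\<close> for every \<open>a\<close>, so an index \<open>j\<close> with
  \<open>p(\<tau> \<union> {j}) = -\<infinity>\<close> does not contribute to the minimum. If all Pluecker coordinates are finite,
  as for \<open>mean_matrix\<close> below, every coordinate is finite (\<open>blue_rule_finite\<close>), and the
  conversion to \<^typ>\<open>real\<close> in \<open>blue_proj\<close> loses nothing.
\<close>

definition blue_rule ::
  "nat \<Rightarrow> nat \<Rightarrow> (nat \<Rightarrow> nat \<Rightarrow> ereal) \<Rightarrow> (nat \<Rightarrow> real) \<Rightarrow> nat \<Rightarrow> ereal" where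
  "blue_rule m d A u i =
     Max ((\<lambda>\<tau>. Min ((\<lambda>j. ereal (u j) + trop_pluecker m A (insert i \<tau>)
                                   - trop_pluecker m A (insert j \<tau>)) ` ({1..d} - \<tau>)))
          ` {\<tau>. \<tau> \<subseteq> {1..d} \<and> card \<tau> = m - 1 \<and> i \<notin> \<tau>})"

definition blue_proj ::
  "nat \<Rightarrow> nat \<Rightarrow> (nat \<Rightarrow> nat \<Rightarrow> ereal) \<Rightarrow> (nat \<Rightarrow> real) \<Rightarrow> nat \<Rightarrow> real" where
  "blue_proj m d A u i = real_of_ereal (blue_rule m d A u i)"

definition mean_matrix :: "nat \<Rightarrow> (nat \<Rightarrow> real) \<Rightarrow> nat \<Rightarrow> nat \<Rightarrow> ereal" where
  "mean_matrix m \<mu> i j = (if j = i then ereal (\<mu> i) else if j \<le> m then -\<infinity> else 0)"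

definition noisy_point :: "nat \<Rightarrow> (nat \<Rightarrow> real) \<Rightarrow> (nat \<Rightarrow> real) \<Rightarrow> nat \<Rightarrow> real" where
  "noisy_point m \<mu> e i = (if i \<le> m then \<mu> i + e i else e i)"

lemma trop_dist_shift:
  assumes "1 \<le> d"
  shows "trop_dist d (\<lambda>i. v i + a) (\<lambda>i. w i + b) = trop_dist d v w"
proof -
  have im: "(\<lambda>i. v i + a - (w i + b)) ` {1..d} = (\<lambda>x. x + (a - b)) ` (\<lambda>i. v i - w i) ` {1..d}"
    by (auto simp: image_image algebra_simps)
  have m: "mono (\<lambda>x::real. x + (a - b))" by (simp add: mono_def)
  have ne: "(\<lambda>i. v i - w i) ` {1..d} \<noteq> {}" using assms by auto
  show ?thesis unfolding trop_dist_def im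
    using mono_Max_commute[OF m _ ne] mono_Min_commute[OF m _ ne] by simp
qed

lemma trop_pluecker_mean_matrix_finite:
  assumes "\<omega> \<subseteq> {1..d}" "card \<omega> = m"
  shows "\<bar>trop_pluecker m (mean_matrix m \<mu>) \<omega>\<bar> \<noteq> \<infinity>"
proof -
  let ?A = "mean_matrix m \<mu>"
  let ?c = "\<lambda>j. sorted_list_of_set \<omega> ! (j - 1)"
  let ?s = "\<lambda>\<pi>. \<Sum>i=1..m. select_cols ?A \<omega> i (\<pi> i)"
  have fin: "finite \<omega>" using assms finite_subset by blast
  define S where "S = \<omega> \<inter> {1..m}"
  have "card (\<omega> - S) = card ({1..m} - S)"
    using assms(2) fin by (simp add: S_def card_Diff_subset)
  then obtain g where g: "bij_betw g ({1..m} - S) (\<omega> - S)"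
    using fin by (metis finite_Diff finite_atLeastAtMost finite_same_card_bij)
  define f where "f = (\<lambda>i. if i \<in> S then i else g i)"
  have "bij_betw f S S" by (rule bij_betw_cong[THEN iffD1, of S id]) (auto simp: f_def)
  moreover have "bij_betw f ({1..m} - S) (\<omega> - S)"
    using g by (rule bij_betw_cong[THEN iffD1, rotated]) (auto simp: f_def)
  ultimately have "bij_betw f (S \<union> ({1..m} - S)) (S \<union> (\<omega> - S))"
    by (rule bij_betw_combine) auto
  moreover have "S \<union> ({1..m} - S) = {1..m}" "S \<union> (\<omega> - S) = \<omega>" by (auto simp: S_def)
  ultimately have f: "bij_betw f {1..m} \<omega>" by simp
  have "bij_betw ((!) (sorted_list_of_set \<omega>)) {..<m} \<omega>"
    using bij_betw_nth[of "sorted_list_of_set \<omega>" "{..<m}" \<omega>] fin assms(2) by simp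
  moreover have "bij_betw (\<lambda>j. j - 1) {1..m} {..<m}"
    by (rule bij_betw_byWitness[where f' = Suc]) auto
  ultimately have c: "bij_betw ?c {1..m} \<omega>"
    using bij_betw_trans[of "\<lambda>j. j - 1" "{1..m}" "{..<m}" "(!) (sorted_list_of_set \<omega>)" \<omega>]
    by (simp add: comp_def)
  define \<pi> where "\<pi> = (\<lambda>i. if i \<in> {1..m} then the_inv_into {1..m} ?c (f i) else i)"
  have "bij_betw (the_inv_into {1..m} ?c \<circ> f) {1..m} {1..m}"
    using f bij_betw_the_inv_into[OF c] by (rule bij_betw_trans)
  then have "bij_betw \<pi> {1..m} {1..m}"
    by (rule bij_betw_cong[THEN iffD1, rotated]) (auto simp: \<pi>_def)
  then have perm: "\<pi> permutes {1..m}"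
    by (rule bij_imp_permutes) (auto simp: \<pi>_def)
  have entry: "\<bar>select_cols ?A \<omega> i (\<pi> i)\<bar> \<noteq> \<infinity>" if i: "i \<in> {1..m}" for i
  proof -
    have "f i \<in> \<omega>" using f i by (auto simp: bij_betw_def)
    then have "?c (\<pi> i) = f i"
      using f_the_inv_into_f_bij_betw[OF c, of "f i"] i unfolding \<pi>_def by simp
    moreover have "f i = i \<or> f i > m"
    proof (cases "i \<in> S")
      case False
      then have "f i \<in> \<omega> - S" using g i by (auto simp: f_def bij_betw_def)
      then show ?thesis using assms(1) by (auto simp: S_def)
    qed (simp add: f_def)
    ultimately show ?thesis by (auto simp: select_cols_def mean_matrix_def)
  qed
  have fp: "finite {\<pi>. \<pi> permutes {1..m}}" by (simp add: finite_permutations)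
  have s1: "?s \<pi> \<noteq> -\<infinity>"
    using entry sum_Inf[of "\<lambda>i. select_cols ?A \<omega> i (\<pi> i)" "{1..m}"] by auto
  have s2: "?s p \<noteq> \<infinity>" for p
    by (subst sum_Pinfty) (auto simp: select_cols_def mean_matrix_def)
  have "?s \<pi> \<le> Max (?s ` {\<pi>. \<pi> permutes {1..m}})"
    using fp perm by (intro Max_ge) auto
  moreover have "Max (?s ` {\<pi>. \<pi> permutes {1..m}}) \<in> ?s ` {\<pi>. \<pi> permutes {1..m}}"
    using fp perm by (intro Max_in) auto
  ultimately obtain p where "trop_pluecker m ?A \<omega> = ?s p" "?s \<pi> \<le> ?s p"
    unfolding trop_pluecker_def tdet_def by (metis (no_types, lifting) imageE)
  then show ?thesis using s1 s2[of p] by (cases "?s p"; cases "?s \<pi>") simp_all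
qed

lemma blue_rule_index_nonempty:
  assumes "1 \<le> m" "m < d" "i \<in> {1..d}"
  shows "{\<tau>. \<tau> \<subseteq> {1..d} \<and> card \<tau> = m - 1 \<and> i \<notin> \<tau>} \<noteq> {}"
proof -
  have "m - 1 \<le> card ({1..d} - {i})" using assms by simp
  then obtain \<tau> where "\<tau> \<subseteq> {1..d} - {i}" "card \<tau> = m - 1"
    by (meson obtain_subset_with_card_n)
  then show ?thesis by auto
qed

lemma blue_rule_finite:
  assumes "1 \<le> m" "m < d" "i \<in> {1..d}"
    and fin: "\<And>\<omega>. \<omega> \<subseteq> {1..d} \<Longrightarrow> card \<omega> = m \<Longrightarrow> \<bar>trop_pluecker m A \<omega>\<bar> \<noteq> \<infinity>"
  shows "\<bar>blue_rule m d A u i\<bar> \<noteq> \<infinity>"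
proof -
  let ?T = "{\<tau>. \<tau> \<subseteq> {1..d} \<and> card \<tau> = m - 1 \<and> i \<notin> \<tau>}"
  let ?t = "\<lambda>\<tau> j. ereal (u j) + trop_pluecker m A (insert i \<tau>) - trop_pluecker m A (insert j \<tau>)"
  let ?M = "\<lambda>\<tau>. Min (?t \<tau> ` ({1..d} - \<tau>))"
  have "finite ?T" by simp
  then have "blue_rule m d A u i \<in> ?M ` ?T"
    unfolding blue_rule_def using blue_rule_index_nonempty[OF assms(1-3)]
    by (intro Max_in) auto
  then obtain \<tau> where \<tau>: "\<tau> \<in> ?T" and eq: "blue_rule m d A u i = ?M \<tau>" by blast
  have "?M \<tau> \<in> ?t \<tau> ` ({1..d} - \<tau>)" using \<tau> assms(3) by (intro Min_in) auto
  then obtain j where j: "j \<in> {1..d} - \<tau>" and eq2: "?M \<tau> = ?t \<tau> j" by blast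
  have "finite \<tau>" using \<tau> finite_subset by blast
  then have "card (insert k \<tau>) = m" if "k \<notin> \<tau>" for k using that \<tau> assms(1) by simp
  then have "\<bar>trop_pluecker m A (insert i \<tau>)\<bar> \<noteq> \<infinity>" "\<bar>trop_pluecker m A (insert j \<tau>)\<bar> \<noteq> \<infinity>"
    using \<tau> j assms(3) by (intro fin; simp)+
  then show ?thesis unfolding eq eq2 by auto
qed

lemma blue_proj_shift:
  assumes "1 \<le> m" "m < d" "i \<in> {1..d}"
    and fin: "\<And>\<omega>. \<omega> \<subseteq> {1..d} \<Longrightarrow> card \<omega> = m \<Longrightarrow> \<bar>trop_pluecker m A \<omega>\<bar> \<noteq> \<infinity>"
  shows "blue_proj m d A (\<lambda>j. u j + a) i = blue_proj m d A u i + a"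
proof -
  let ?T = "{\<tau>. \<tau> \<subseteq> {1..d} \<and> card \<tau> = m - 1 \<and> i \<notin> \<tau>}"
  let ?t = "\<lambda>u \<tau> j. ereal (u j) + trop_pluecker m A (insert i \<tau>) - trop_pluecker m A (insert j \<tau>)"
  let ?M = "\<lambda>u \<tau>. Min (?t u \<tau> ` ({1..d} - \<tau>))"
  have mono: "mono (\<lambda>x. x + ereal a)" by (simp add: mono_def add_right_mono)
  have "?t (\<lambda>j. u j + a) \<tau> j = ?t u \<tau> j + ereal a" for \<tau> j
    by (simp add: minus_ereal_def ac_simps flip: plus_ereal.simps(1))
  then have im: "?t (\<lambda>j. u j + a) \<tau> ` J = (\<lambda>x. x + ereal a) ` ?t u \<tau> ` J" for \<tau> J
    by (simp add: image_image)
  have M: "?M (\<lambda>j. u j + a) \<tau> = ?M u \<tau> + ereal a" if "\<tau> \<in> ?T" for \<tau>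
    unfolding im using that assms(3) by (subst mono_Min_commute[OF mono]) auto
  have "?M (\<lambda>j. u j + a) ` ?T = (\<lambda>x. x + ereal a) ` ?M u ` ?T"
    unfolding image_image by (intro image_cong refl M)
  then have "blue_rule m d A (\<lambda>j. u j + a) i = blue_rule m d A u i + ereal a"
    unfolding blue_rule_def
    using mono_Max_commute[OF mono, of "?M u ` ?T"] blue_rule_index_nonempty[OF assms(1-3)]
    by simp
  then show ?thesis
    using blue_rule_finite[OF assms(1-3) fin, of u] unfolding blue_proj_def by auto
qed

end

theory Submission imports Defs begin

text \<open>
  Let \<open>c = (\<mu>\<^sub>1, \<dots>, \<mu>\<^sub>m, 0, \<dots>, 0)\<close> be the noiseless point. A permutation contributes a finite term
  to the tropical determinant of \<open>A\<^sub>\<omega>\<close> only if it matches every column \<open>j \<le> m\<close> with row \<open>j\<close>, and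
  each such term is the sum of \<open>c\<close> over \<open>\<omega>\<close>. The Pluecker coordinates are therefore
  modular: \<open>p(\<omega>) = \<Sum>j\<in>\<omega>. c\<^sub>j\<close> (\<open>trop_pluecker_mean_matrix\<close>).

  In the Blue Rule the contributions of \<open>\<tau>\<close> then cancel, and the projection of \<open>c + e\<close> has the
  coordinates \<open>c\<^sub>i + max\<^sub>\<tau> min\<^sub>j e\<^sub>j\<close>, where \<open>\<tau>\<close> runs over the \<open>(m-1)\<close>-sets that avoid \<open>i\<close>, and
  \<open>j\<close> over the complement of \<open>\<tau>\<close> (\<open>blue_proj_modular\<close>). So \<open>c\<close> is its own projection, and after
  the noise \<open>e\<close> is added every coordinate of the projection still differs from that of \<open>c\<close> by one
  of the \<open>e\<^sub>j\<close>. Hence \<open>d\<^sub>t\<^sub>r(X, X') \<le> 4 \<Sum>j. \<bar>\<epsilon>\<^sub>j\<bar>\<close>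
  (\<open>trop_dist_blue_proj_modular_le\<close>).

  Since a centred Gaussian of standard deviation \<open>\<sigma>\<close> has absolute first moment \<open>\<sigma> sqrt (2 / \<pi>)\<close>,
  the expected distance is at most \<open>4 d \<sigma> sqrt (2 / \<pi>)\<close>, which tends to \<open>0\<close>.
\<close>

abbreviation mean_point :: "nat \<Rightarrow> (nat \<Rightarrow> real) \<Rightarrow> nat \<Rightarrow> real" where
  "mean_point m \<mu> \<equiv> noisy_point m \<mu> (\<lambda>_. 0)"

lemma noisy_point_eq: "noisy_point m \<mu> e = (\<lambda>i. mean_point m \<mu> i + e i)"
  by (auto simp: noisy_point_def)

text \<open>
  A finite entry of the matrix depends on its column only: it is the coordinate of the noiseless
  point there. So all permutations with a finite weight have the same weight, and one
  exists because the Pluecker coordinate, the largest weight, is finite.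
\<close>

lemma trop_pluecker_mean_matrix:
  assumes "\<omega> \<subseteq> {1..d}" "card \<omega> = m"
  shows "trop_pluecker m (mean_matrix m \<mu>) \<omega> = ereal (\<Sum>j\<in>\<omega>. mean_point m \<mu> j)"
proof -
  let ?A = "mean_matrix m \<mu>"
  let ?col = "\<lambda>j. sorted_list_of_set \<omega> ! (j - 1)"
  let ?weight = "\<lambda>\<pi>. \<Sum>i=1..m. select_cols ?A \<omega> i (\<pi> i)"
  let ?perms = "{\<pi>. \<pi> permutes {1..m}}"
  have fin: "finite \<omega>" using assms(1) finite_subset by blast
  have "id \<in> ?perms" by (simp add: permutes_id)
  then have "?weight ` ?perms \<noteq> {}" by blast
  then have "Max (?weight ` ?perms) \<in> ?weight ` ?perms"
    by (intro Max_in finite_imageI finite_permutations) simp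
  then obtain \<pi> where \<pi>: "\<pi> permutes {1..m}"
    and p: "trop_pluecker m ?A \<omega> = ?weight \<pi>"
    unfolding trop_pluecker_def tdet_def by blast
  have fin_weight: "\<bar>?weight \<pi>\<bar> \<noteq> \<infinity>"
    using trop_pluecker_mean_matrix_finite[OF assms, of \<mu>] p by simp
  have entry: "select_cols ?A \<omega> i (\<pi> i) = ereal (mean_point m \<mu> (?col (\<pi> i)))"
    if i: "i \<in> {1..m}" for i
  proof -
    have "\<bar>select_cols ?A \<omega> i (\<pi> i)\<bar> \<noteq> \<infinity>"
      using fin_weight i unfolding sum_Inf by (meson finite_atLeastAtMost)
    then show ?thesis
      using i by (auto simp: select_cols_def mean_matrix_def noisy_point_def zero_ereal_def
          split: if_splits)
  qed
  have "bij_betw ((!) (sorted_list_of_set \<omega>)) {..<m} \<omega>"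
    using bij_betw_nth[of "sorted_list_of_set \<omega>" "{..<m}" \<omega>] fin assms(2) by simp
  moreover have "bij_betw (\<lambda>j. j - 1) {1..m} {..<m}"
    by (rule bij_betw_byWitness[where f' = Suc]) auto
  ultimately have "bij_betw ?col {1..m} \<omega>"
    using bij_betw_trans[of "\<lambda>j. j - 1" "{1..m}" "{..<m}" "(!) (sorted_list_of_set \<omega>)" \<omega>]
    by (simp add: comp_def)
  then have bij: "bij_betw (\<lambda>i. ?col (\<pi> i)) {1..m} \<omega>"
    using bij_betw_trans[OF permutes_imp_bij[OF \<pi>]] by (simp add: comp_def)
  have "?weight \<pi> = (\<Sum>i=1..m. ereal (mean_point m \<mu> (?col (\<pi> i))))"
    using entry by (rule sum.cong[OF refl])
  also have "\<dots> = ereal (\<Sum>j\<in>\<omega>. mean_point m \<mu> j)"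
    using sum.reindex_bij_betw[OF bij, of "mean_point m \<mu>"] by simp
  finally show ?thesis using p by simp
qed

text \<open>
  The value on the noise \<open>e\<close> of the max-min expression that the Blue Rule becomes when all
  Pluecker coordinates vanish.
\<close>

definition noise_level :: "nat \<Rightarrow> nat \<Rightarrow> (nat \<Rightarrow> real) \<Rightarrow> nat \<Rightarrow> real" where
  "noise_level m d e i =
     Max ((\<lambda>\<tau>. Min (e ` ({1..d} - \<tau>))) ` {\<tau>. \<tau> \<subseteq> {1..d} \<and> card \<tau> = m - 1 \<and> i \<notin> \<tau>})"

lemma noise_level_in_range:
  assumes "1 \<le> m" "m < d" "i \<in> {1..d}"
  shows "noise_level m d e i \<in> e ` {1..d}"
proof -
  let ?T = "{\<tau>. \<tau> \<subseteq> {1..d} \<and> card \<tau> = m - 1 \<and> i \<notin> \<tau>}"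
  let ?M = "\<lambda>\<tau>. Min (e ` ({1..d} - \<tau>))"
  have "finite ?T" by simp
  then have "Max (?M ` ?T) \<in> ?M ` ?T"
    using blue_rule_index_nonempty[OF assms] by (intro Max_in) auto
  then obtain \<tau> where \<tau>: "\<tau> \<in> ?T" and eq: "noise_level m d e i = ?M \<tau>"
    unfolding noise_level_def by blast
  have "?M \<tau> \<in> e ` ({1..d} - \<tau>)" using \<tau> assms(3) by (intro Min_in) auto
  then show ?thesis using eq by auto
qed

lemma borel_measurable_noise_level:
  assumes "\<And>j. j \<in> {1..d} \<Longrightarrow> (\<lambda>x. e x j) \<in> borel_measurable N"
  shows "(\<lambda>x. noise_level m d (e x) i) \<in> borel_measurable N"
  unfolding noise_level_def
proof (rule borel_measurable_Max)
  show "finite {\<tau>. \<tau> \<subseteq> {1..d} \<and> card \<tau> = m - 1 \<and> i \<notin> \<tau>}" by simp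
  show "(\<lambda>x. Min (e x ` ({1..d} - \<tau>))) \<in> borel_measurable N" for \<tau>
    using assms by (intro borel_measurable_Min) auto
qed

text \<open>
  For modular Pluecker coordinates \<open>p(\<tau> \<union> {i}) - p(\<tau> \<union> {j}) = c\<^sub>i - c\<^sub>j\<close>. Translation by \<open>c\<close>
  thus reduces the Blue Rule to the case where all coordinates vanish.
\<close>

lemma blue_proj_modular:
  assumes "1 \<le> m" "m < d" "i \<in> {1..d}"
    and p: "\<And>\<omega>. \<omega> \<subseteq> {1..d} \<Longrightarrow> card \<omega> = m \<Longrightarrow> trop_pluecker m A \<omega> = ereal (\<Sum>j\<in>\<omega>. c j)"
  shows "blue_proj m d A (\<lambda>j. c j + e j) i = c i + noise_level m d e i"
proof -
  let ?T = "{\<tau>. \<tau> \<subseteq> {1..d} \<and> card \<tau> = m - 1 \<and> i \<notin> \<tau>}"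
  let ?t = "\<lambda>\<tau> j. ereal (c j + e j) + trop_pluecker m A (insert i \<tau>) - trop_pluecker m A (insert j \<tau>)"
  let ?f = "\<lambda>x. ereal (c i + x)"
  have mono: "mono ?f" by (simp add: mono_def)
  have t: "?t \<tau> j = ?f (e j)" if \<tau>: "\<tau> \<in> ?T" and j: "j \<in> {1..d} - \<tau>" for \<tau> j
  proof -
    have fin: "finite \<tau>" using \<tau> finite_subset by blast
    have "trop_pluecker m A (insert k \<tau>) = ereal (c k + (\<Sum>j\<in>\<tau>. c j))"
      if "k \<in> {1..d} - \<tau>" for k
      using that \<tau> fin assms(1) by (subst p) auto
    from this[OF j] this[of i] show ?thesis using \<tau> assms(3) by simp
  qed
  have M: "Min (?t \<tau> ` ({1..d} - \<tau>)) = ?f (Min (e ` ({1..d} - \<tau>)))" if \<tau>: "\<tau> \<in> ?T" for \<tau>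
  proof -
    have "?t \<tau> ` ({1..d} - \<tau>) = ?f ` e ` ({1..d} - \<tau>)"
      unfolding image_image using t[OF \<tau>] by (rule image_cong[OF refl])
    moreover have "{1..d} - \<tau> \<noteq> {}" using \<tau> assms(3) by auto
    ultimately show ?thesis
      using mono_Min_commute[OF mono, of "e ` ({1..d} - \<tau>)"] by simp
  qed
  have "(\<lambda>\<tau>. Min (?t \<tau> ` ({1..d} - \<tau>))) ` ?T = ?f ` (\<lambda>\<tau>. Min (e ` ({1..d} - \<tau>))) ` ?T"
    unfolding image_image using M by (rule image_cong[OF refl])
  then have "blue_rule m d A (\<lambda>j. c j + e j) i = ?f (noise_level m d e i)"
    unfolding blue_rule_def noise_level_def
    using mono_Max_commute[OF mono, of "(\<lambda>\<tau>. Min (e ` ({1..d} - \<tau>))) ` ?T"]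
      blue_rule_index_nonempty[OF assms(1-3)] by simp
  then show ?thesis by (simp add: blue_proj_def)
qed

lemma trop_dist_le:
  assumes "1 \<le> d" and "\<And>i. i \<in> {1..d} \<Longrightarrow> \<bar>v i - w i\<bar> \<le> b"
  shows "trop_dist d v w \<le> 2 * b"
proof -
  let ?D = "(\<lambda>i. v i - w i) ` {1..d}"
  have "Max ?D \<in> ?D" "Min ?D \<in> ?D" using assms(1) by (auto intro!: Max_in Min_in)
  then have "\<bar>Max ?D\<bar> \<le> b" "\<bar>Min ?D\<bar> \<le> b" using assms(2) by auto
  then show ?thesis unfolding trop_dist_def by linarith
qed

lemma trop_dist_nonneg:
  assumes "1 \<le> d"
  shows "0 \<le> trop_dist d v w"
proof -
  let ?D = "(\<lambda>i. v i - w i) ` {1..d}"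
  have "v 1 - w 1 \<in> ?D" using assms by auto
  then have "Min ?D \<le> v 1 - w 1" "v 1 - w 1 \<le> Max ?D" by (auto intro: Min_le Max_ge)
  then show ?thesis unfolding trop_dist_def by linarith
qed

lemma borel_measurable_trop_dist:
  assumes "\<And>i. i \<in> {1..d} \<Longrightarrow> (\<lambda>x. v x i) \<in> borel_measurable N"
    and "\<And>i. i \<in> {1..d} \<Longrightarrow> (\<lambda>x. w x i) \<in> borel_measurable N"
  shows "(\<lambda>x. trop_dist d (v x) (w x)) \<in> borel_measurable N"
  unfolding trop_dist_def using assms
  by (intro borel_measurable_diff borel_measurable_Max borel_measurable_Min) auto

text \<open>
  Both the point and its projection lie within \<open>\<Sum>j. \<bar>e\<^sub>j\<bar>\<close> of \<open>c\<close> in every coordinate, and the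
  tropical distance is at most twice the distance in the maximum norm.
\<close>

lemma trop_dist_blue_proj_modular_le:
  assumes "1 \<le> m" "m < d"
    and p: "\<And>\<omega>. \<omega> \<subseteq> {1..d} \<Longrightarrow> card \<omega> = m \<Longrightarrow> trop_pluecker m A \<omega> = ereal (\<Sum>j\<in>\<omega>. c j)"
  shows "trop_dist d (\<lambda>j. c j + e j) (blue_proj m d A (\<lambda>j. c j + e j)) \<le> 4 * (\<Sum>j=1..d. \<bar>e j\<bar>)"
proof -
  have le: "\<bar>e k\<bar> \<le> (\<Sum>j=1..d. \<bar>e j\<bar>)" if "k \<in> {1..d}" for k
    using that by (intro member_le_sum) auto
  have "\<bar>c i + e i - blue_proj m d A (\<lambda>j. c j + e j) i\<bar> \<le> 2 * (\<Sum>j=1..d. \<bar>e j\<bar>)"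
    if i: "i \<in> {1..d}" for i
  proof -
    obtain k where k: "k \<in> {1..d}" "noise_level m d e i = e k"
      using noise_level_in_range[OF assms(1,2) i, of e] by auto
    have "blue_proj m d A (\<lambda>j. c j + e j) i = c i + e k"
      using blue_proj_modular[OF assms(1,2) i p] k(2) by simp
    then show ?thesis using le[OF i] le[OF k(1)] by linarith
  qed
  then have "trop_dist d (\<lambda>j. c j + e j) (blue_proj m d A (\<lambda>j. c j + e j))
      \<le> 2 * (2 * (\<Sum>j=1..d. \<bar>e j\<bar>))"
    using assms(2) by (intro trop_dist_le) auto
  then show ?thesis by simp
qed

lemma normal_absolute_first_moment:
  assumes "0 < \<sigma>" and D: "distributed N lborel Y (normal_density 0 \<sigma>)"
  shows "has_bochner_integral N (\<lambda>x. \<bar>Y x\<bar>) (\<sigma> * sqrt (2 / pi))"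
proof -
  have moment: "has_bochner_integral lborel (\<lambda>x. normal_density 0 \<sigma> x * \<bar>x\<bar>) (\<sigma> * sqrt (2 / pi))"
    using normal_moment_abs_odd[OF assms(1), of 0 0] by simp
  have "integrable N (\<lambda>x. \<bar>Y x\<bar>)"
    using distributed_integrable[OF D, of "\<lambda>x. \<bar>x\<bar>"] moment
    by (simp add: has_bochner_integral_iff)
  moreover have "(\<integral>x. \<bar>Y x\<bar> \<partial>N) = \<sigma> * sqrt (2 / pi)"
    using distributed_integral[OF D, of "\<lambda>x. \<bar>x\<bar>"] moment
    by (simp add: has_bochner_integral_iff)
  ultimately show ?thesis by (simp add: has_bochner_integral_iff)
qed

theorem theorem13:
  fixes m d :: nat and \<mu> :: "nat \<Rightarrow> real"
    and M :: "real \<Rightarrow> 'a measure" and \<epsilon> :: "real \<Rightarrow> nat \<Rightarrow> 'a \<Rightarrow> real"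
    and X X' :: "real \<Rightarrow> 'a \<Rightarrow> nat \<Rightarrow> real"
  assumes "1 \<le> m" and "m < d"
    and "\<And>\<sigma>. \<sigma> > 0 \<Longrightarrow> prob_space (M \<sigma>)"
    and "\<And>\<sigma>. \<sigma> > 0 \<Longrightarrow> prob_space.indep_vars (M \<sigma>) (\<lambda>_. borel) (\<epsilon> \<sigma>) {1..d}"
    and "\<And>\<sigma> i. \<sigma> > 0 \<Longrightarrow> i \<in> {1..d} \<Longrightarrow> distributed (M \<sigma>) lborel (\<epsilon> \<sigma> i) (normal_density 0 \<sigma>)"
  defines "X \<equiv> \<lambda>\<sigma> x. noisy_point m \<mu> (\<lambda>i. \<epsilon> \<sigma> i x)"
    and "X' \<equiv> \<lambda>\<sigma> x. blue_proj m d (mean_matrix m \<mu>) (X \<sigma> x)"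
  shows "(\<forall>\<sigma>>0. integrable (M \<sigma>) (\<lambda>x. trop_dist d (X \<sigma> x) (X' \<sigma> x))) \<and>
    ((\<lambda>\<sigma>. prob_space.expectation (M \<sigma>) (\<lambda>x. trop_dist d (X \<sigma> x) (X' \<sigma> x))) \<longlongrightarrow> 0) (at_right 0)"
proof -
  let ?c = "mean_point m \<mu>"
  let ?dist = "\<lambda>\<sigma> x. trop_dist d (X \<sigma> x) (X' \<sigma> x)"
  let ?noise = "\<lambda>\<sigma> x. 4 * (\<Sum>j=1..d. \<bar>\<epsilon> \<sigma> j x\<bar>)"
  let ?K = "4 * (real d * sqrt (2 / pi))"
  have d: "1 \<le> d" using assms(1,2) by simp
  have X: "X \<sigma> x = (\<lambda>i. ?c i + \<epsilon> \<sigma> i x)" for \<sigma> x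
    unfolding X_def by (rule noisy_point_eq)
  have X': "X' \<sigma> x i = ?c i + noise_level m d (\<lambda>j. \<epsilon> \<sigma> j x) i" if "i \<in> {1..d}" for \<sigma> x i
    unfolding X'_def X
    using blue_proj_modular[OF assms(1,2) that trop_pluecker_mean_matrix] .
  have le: "?dist \<sigma> x \<le> ?noise \<sigma> x" for \<sigma> x
    unfolding X'_def X
    using trop_dist_blue_proj_modular_le[OF assms(1,2) trop_pluecker_mean_matrix] .
  have nonneg: "0 \<le> ?dist \<sigma> x" for \<sigma> x by (rule trop_dist_nonneg[OF d])
  have noise: "has_bochner_integral (M \<sigma>) (?noise \<sigma>) (?K * \<sigma>)" if "\<sigma> > 0" for \<sigma>
  proof -
    have "has_bochner_integral (M \<sigma>) (?noise \<sigma>) (4 * (\<Sum>j=1..d. \<sigma> * sqrt (2 / pi)))"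
      using normal_absolute_first_moment[OF that assms(5)[OF that]]
      by (intro has_bochner_integral_mult_right has_bochner_integral_sum)
    then show ?thesis by (simp add: ac_simps)
  qed
  have int: "integrable (M \<sigma>) (?dist \<sigma>)" if "\<sigma> > 0" for \<sigma>
  proof (rule Bochner_Integration.integrable_bound)
    show "integrable (M \<sigma>) (?noise \<sigma>)" using noise[OF that] by (rule integrable.intros)
    have \<epsilon>: "\<epsilon> \<sigma> i \<in> borel_measurable (M \<sigma>)" if "i \<in> {1..d}" for i
      using distributed_measurable[OF assms(5)[OF \<open>\<sigma> > 0\<close> that]] by simp
    have "(\<lambda>x. X \<sigma> x i) \<in> borel_measurable (M \<sigma>)" if "i \<in> {1..d}" for i
      unfolding X using \<epsilon>[OF that] by simp
    moreover have "(\<lambda>x. X' \<sigma> x i) \<in> borel_measurable (M \<sigma>)" if "i \<in> {1..d}" for i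
      using borel_measurable_noise_level[of d "\<lambda>x j. \<epsilon> \<sigma> j x" "M \<sigma>" m i] \<epsilon> that
      by (simp add: X'[OF that])
    ultimately show "?dist \<sigma> \<in> borel_measurable (M \<sigma>)" by (rule borel_measurable_trop_dist)
    show "AE x in M \<sigma>. norm (?dist \<sigma> x) \<le> norm (?noise \<sigma> x)"
    proof (rule AE_I2)
      fix x
      show "norm (?dist \<sigma> x) \<le> norm (?noise \<sigma> x)"
        using le[of \<sigma> x] nonneg[of \<sigma> x] unfolding real_norm_def by linarith
    qed
  qed
  have upper: "(\<integral>x. ?dist \<sigma> x \<partial>M \<sigma>) \<le> ?K * \<sigma>" if "\<sigma> > 0" for \<sigma>
  proof -
    have "(\<integral>x. ?dist \<sigma> x \<partial>M \<sigma>) \<le> (\<integral>x. ?noise \<sigma> x \<partial>M \<sigma>)"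
      using noise[OF that] int[OF that] le
      by (intro integral_mono) (auto simp: has_bochner_integral_iff)
    also have "\<dots> = ?K * \<sigma>" using noise[OF that] by (rule has_bochner_integral_integral_eq)
    finally show ?thesis .
  qed
  have "((\<lambda>\<sigma>. \<integral>x. ?dist \<sigma> x \<partial>M \<sigma>) \<longlongrightarrow> 0) (at_right 0)"
  proof (rule tendsto_sandwich)
    show "\<forall>\<^sub>F \<sigma> in at_right 0. 0 \<le> (\<integral>x. ?dist \<sigma> x \<partial>M \<sigma>)"
      using nonneg by (intro always_eventually allI integral_nonneg_AE AE_I2)
    show "\<forall>\<^sub>F \<sigma> in at_right 0. (\<integral>x. ?dist \<sigma> x \<partial>M \<sigma>) \<le> ?K * \<sigma>"
      using eventually_at_right_less by eventually_elim (rule upper)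
    show "((\<lambda>_. 0) \<longlongrightarrow> 0) (at_right (0::real))" by simp
    have "((\<lambda>\<sigma>. ?K * \<sigma>) \<longlongrightarrow> ?K * 0) (at_right 0)" by (intro tendsto_intros)
    then show "((\<lambda>\<sigma>. ?K * \<sigma>) \<longlongrightarrow> 0) (at_right 0)" by simp
  qed
  then show ?thesis using int by blast
qed

end
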